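(* Let $\mathcal{U},\mathcal{V}$ be linear subspaces of $\mathbb{R}^n$ with $\dim(\mathcal{U}\cap\mathcal{V})<\min(\dim\mathcal{U},\dim\mathcal{V})$, so that their Friedrichs angle $\theta_F\in(0,\pi/2]$ is defined. Put $$\alpha=1,\qquad \alpha_1=\alpha_2=\alpha^*:=\frac{2}{1+\sin\theta_F},\qquad \gamma^*:=\frac{1-\sin\theta_F}{1+\sin\theta_F},$$ and let $S=(1-\alpha)I+\alpha P_{\mathcal{U}}^{\alpha_2}P_{\mathcal{V}}^{\alpha_1}$ be the generalized alternating projections operator with these parameters. Then $\gamma(S)=\gamma^*$, and $S$ is linearly convergent with any rate $\mu\in(\gamma^*,1)$.
   Context: $P_{\mathcal{C}}$ denotes the orthogonal projection onto $\mathcal{C}$, and $P_{\mathcal{C}}^{\alpha}:=(1-\alpha)I+\alpha P_{\mathcal{C}}$ is the relaxed projection with relaxation parameter $\alpha$. Principal angles: for subspaces $\mathcal{U},\mathcal{V}\subseteq\mathbb{R}^n$ and $m=\min(\dim\mathcal{U},\dim\mathcal{V})$, the principal angles $\theta_k\in[0,\pi/2]$, $k=1,\dots,m$, are defined recursively by $\cos\theta_k:=\max\langle u_k,v_k\rangle$ over $u_k\in\mathcal{U}$, $v_k\in\mathcal{V}$ with $\|u_k\|=\|v_k\|=1$ and $\langle u_k,v_i\rangle=\langle u_i,v_k\rangle=0$ for $i=1,\dots,k-1$ (where $u_i,v_i$ are maximizers from the earlier steps). They satisfy $0\le\theta_1\le\dots\le\theta_m\le\pi/2$. The Friedrichs angle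 is $\theta_F:=\theta_{s+1}$ with $s=\dim(\mathcal{U}\cap\mathcal{V})$; it is the smallest non-zero principal angle. For $A\in\mathbb{R}^{n\times n}$ with spectrum (set of complex eigenvalues) $\sigma(A)$, $\gamma(A):=\max\{|\lambda| : \lambda\in\{0\}\cup\sigma(A)\setminus\{1\}\}$. $A\in\mathbb{R}^{n\times n}$ is linearly convergent with rate $\mu\in[0,1)$ if there is a matrix $A^\infty$ and $M,N>0$ such that $\|A^k-A^\infty\|\le M\mu^k$ for all $k\in\mathbb{N}$, $k>N$ (operator norm). *)

theory Defs
  imports "HOL-Analysis.Analysis"
begin

definition relaxed_proj :: "real \<Rightarrow> (real ^ 'n) set \<Rightarrow> real ^ 'n \<Rightarrow> real ^ 'n" where
  "relaxed_proj \<alpha> C x = (1 - \<alpha>) *\<^sub>R x + \<alpha> *\<^sub>R closest_point C x"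

definition gap_operator ::
  "(real ^ 'n) set \<Rightarrow> (real ^ 'n) set \<Rightarrow> real \<Rightarrow> real \<Rightarrow> real \<Rightarrow> real ^ 'n \<Rightarrow> real ^ 'n" where
  "gap_operator U V \<alpha> \<alpha>\<^sub>1 \<alpha>\<^sub>2 x =
     (1 - \<alpha>) *\<^sub>R x + \<alpha> *\<^sub>R relaxed_proj \<alpha>\<^sub>2 U (relaxed_proj \<alpha>\<^sub>1 V x)"

lemma linear_closest_point_subspace:
  fixes U :: "(real ^ 'n) set"
  assumes U: "subspace U"
  shows "linear (closest_point U)"
proof -
  have in_U: "closest_point U x \<in> U" for x
    using closest_point_in_set[of U x] closed_subspace[OF U] subspace_0[OF U] by blast
  have ineq: "(x - closest_point U x) \<bullet> (y - closest_point U x) \<le> 0" if "y \<in> U" for x y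
    using closest_point_dot[of U y x] subspace_imp_convex[OF U] closed_subspace[OF U] that by blast
  have orth: "(x - closest_point U x) \<bullet> y = 0" if "y \<in> U" for x y
    using ineq[of "closest_point U x + y" x] ineq[of "closest_point U x - y" x] in_U[of x] that U
    by (simp add: subspace_add subspace_diff)
  have uniq: "closest_point U x = p" if p: "p \<in> U" "\<And>y. y \<in> U \<Longrightarrow> (x - p) \<bullet> y = 0" for x p
  proof -
    let ?d = "closest_point U x - p"
    have d: "?d \<in> U" using in_U p(1) U by (simp add: subspace_diff)
    have "?d \<bullet> ?d = (x - p) \<bullet> ?d - (x - closest_point U x) \<bullet> ?d"
      by (simp add: inner_diff_left)
    then show ?thesis using p(2)[OF d] orth[OF d, of x] by simp
  qed
  show ?thesis
  proof (rule linearI)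
    fix x y :: "real ^ 'n" and c :: real
    show "closest_point U (x + y) = closest_point U x + closest_point U y"
      using orth[of _ x] orth[of _ y] in_U U
      by (intro uniq) (auto simp: subspace_add inner_diff_left inner_add_left)
    show "closest_point U (c *\<^sub>R x) = c *\<^sub>R closest_point U x"
      using orth[of _ x] in_U U
      by (intro uniq) (auto simp: subspace_scale inner_diff_left)
  qed
qed

lemma linear_relaxed_proj:
  fixes U :: "(real ^ 'n) set"
  assumes "subspace U"
  shows "linear (relaxed_proj \<alpha> U)"
  using linear_closest_point_subspace[OF assms]
  by (auto intro!: linearI simp: relaxed_proj_def linear_add linear_scale algebra_simps)

lemma linear_gap_operator:
  fixes U V :: "(real ^ 'n) set"
  assumes "subspace U" and "subspace V"
  shows "linear (gap_operator U V \<alpha> \<alpha>\<^sub>1 \<alpha>\<^sub>2)"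
  using linear_relaxed_proj[OF assms(1)] linear_relaxed_proj[OF assms(2)]
  by (auto intro!: linearI simp: gap_operator_def linear_add linear_scale algebra_simps)

definition admissible_pairs ::
  "(real ^ 'n) set \<Rightarrow> (real ^ 'n) set \<Rightarrow> (nat \<Rightarrow> real ^ 'n) \<Rightarrow> (nat \<Rightarrow> real ^ 'n) \<Rightarrow> nat
     \<Rightarrow> ((real ^ 'n) \<times> (real ^ 'n)) set" where
  "admissible_pairs U V u v k =
     {(x, y). x \<in> U \<and> y \<in> V \<and> norm x = 1 \<and> norm y = 1 \<and>
              (\<forall>i\<in>{1..<k}. x \<bullet> v i = 0 \<and> u i \<bullet> y = 0)}"

text \<open>Only the values at the indices \<open>1, \<dots>, min (dim U) (dim V)\<close> matter.\<close>

definition principal_vectors ::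
  "(real ^ 'n) set \<Rightarrow> (real ^ 'n) set \<Rightarrow> (nat \<Rightarrow> real ^ 'n) \<Rightarrow> (nat \<Rightarrow> real ^ 'n) \<Rightarrow> bool" where
  "principal_vectors U V u v \<longleftrightarrow>
     (\<forall>k\<in>{1..min (dim U) (dim V)}.
        (u k, v k) \<in> admissible_pairs U V u v k \<and>
        (\<forall>(x, y)\<in>admissible_pairs U V u v k. x \<bullet> y \<le> u k \<bullet> v k))"

text \<open>
  Maximizers are not unique, but the maxima do not depend on them, so no choice is fixed here.
\<close>

definition principal_angle :: "(real ^ 'n) set \<Rightarrow> (real ^ 'n) set \<Rightarrow> nat \<Rightarrow> real" where
  "principal_angle U V k =
     (THE \<theta>. \<theta> \<in> {0..pi / 2} \<and> (\<exists>u v. principal_vectors U V u v \<and> cos \<theta> = u k \<bullet> v k))"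

definition friedrichs_angle :: "(real ^ 'n) set \<Rightarrow> (real ^ 'n) set \<Rightarrow> real" where
  "friedrichs_angle U V = principal_angle U V (dim (U \<inter> V) + 1)"

definition spectrum :: "real ^ 'n ^ 'n \<Rightarrow> complex set" where
  "spectrum A =
     {c. \<exists>z :: complex ^ 'n. z \<noteq> 0 \<and> map_matrix complex_of_real A *v z = c *s z}"

definition subdominant_modulus :: "real ^ 'n ^ 'n \<Rightarrow> real" where
  "subdominant_modulus A = Max (cmod ` ({0} \<union> (spectrum A - {1})))"

text \<open>The operation \<open>^\<close> on the type of matrices is the componentwise power.\<close>

primrec matrix_power :: "real ^ 'n ^ 'n \<Rightarrow> nat \<Rightarrow> real ^ 'n ^ 'n" where
  "matrix_power A 0 = mat 1"
| "matrix_power A (Suc k) = A ** matrix_power A k"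

definition linearly_convergent :: "real ^ 'n ^ 'n \<Rightarrow> real \<Rightarrow> bool" where
  "linearly_convergent A \<mu> \<longleftrightarrow>
     \<mu> \<in> {0..<1} \<and>
     (\<exists>A_inf M N. M > 0 \<and> N > 0 \<and>
        (\<forall>k::nat. real k > N \<longrightarrow> onorm ((*v) (matrix_power A k - A_inf)) \<le> M * \<mu> ^ k))"

end

theory Submission
  imports Defs
begin

text \<open>
  Let \<open>p\<close>, \<open>q\<close> be the projections onto \<open>U\<close>, \<open>V\<close> and \<open>b = \<gamma>\<^sup>*\<close>, so that \<open>\<alpha>\<^sup>* = 1 + b\<close>. Instead of the
  block diagonalization by principal angles, we use that \<open>T = ((1 + b) p - b) ((1 + b) q - b)\<close>
  satisfies \<open>T\<^sup>2 = K T - b\<^sup>2\<close>, where \<open>K = 1 + b\<^sup>2 - (1 + b)\<^sup>2 (p - q)\<^sup>2\<close> is symmetric. On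
  \<open>X = (U + V) \<inter> (U \<inter> V)\<^sup>\<bottom>\<close> one has \<open>sin\<^sup>2 \<theta>\<^sub>F \<le> (p - q)\<^sup>2 \<le> 1\<close>, which for the optimal parameter says
  precisely \<open>-2b \<le> K \<le> 2b\<close>. Hence eigenvalues of \<open>T\<close> on \<open>X\<close> are zero or of modulus \<open>b\<close>, and
  \<open>\<parallel>T\<^sup>k x\<parallel>\<close> grows at most like \<open>k b\<^sup>k\<close>. Off \<open>X\<close>, the operator is the identity on \<open>U \<inter> V\<close> and \<open>b\<^sup>2\<close> on
  \<open>(U + V)\<^sup>\<bottom>\<close>. The bound \<open>b\<close> is attained in the plane of a pair realizing \<open>\<theta>\<^sub>F\<close>.
\<close>

subsection \<open>A pair of projections in a Euclidean space\<close>

lemma norm_diff_orthogonal: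
  fixes u v :: "'a::real_inner"
  assumes "u \<bullet> v = 0"
  shows "(norm (u - v))\<^sup>2 = (norm u)\<^sup>2 + (norm v)\<^sup>2"
  using assms by (simp add: power2_norm_eq_inner algebra_simps inner_commute)

text \<open>Testing against every \<open>w\<close> turns a vector identity into a scalar one, which
  ring normalization settles. The longer computations with \<open>p\<close> and \<open>q\<close>
  rely on this.\<close>

lemma eq_if_inner_eq:
  fixes u v :: "'a::real_inner"
  assumes "\<And>w. u \<bullet> w = v \<bullet> w"
  shows "u = v"
  using assms vector_eq_rdot by blast

locale orth_projection =
  fixes p :: "'a::real_inner \<Rightarrow> 'a"
  assumes lin: "linear p"
    and idem [simp]: "p (p x) = p x"
    and sym: "p x \<bullet> y = x \<bullet> p y"
begin

lemma add: "p (x + y) = p x + p y"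
  and diff: "p (x - y) = p x - p y"
  and scale: "p (r *\<^sub>R x) = r *\<^sub>R p x"
  and neg: "p (- x) = - p x"
  and zero [simp]: "p 0 = 0"
  using lin by (simp_all add: linear_add linear_diff linear_scale linear_neg linear_0)

lemma inner_self: "p x \<bullet> p x = p x \<bullet> x"
  by (metis idem sym)

lemma orth: "p x \<bullet> (y - p y) = 0"
  by (simp add: sym diff)

lemma norm_le: "norm (p x) \<le> norm x"
proof -
  have "norm (p x) * norm (p x) \<le> norm (p x) * norm x"
    using norm_cauchy_schwarz[of "p x" x] by (simp add: inner_self[symmetric] dot_square_norm power2_eq_square)
  then show ?thesis by (metis mult_le_cancel_left norm_ge_zero order_le_less)
qed

lemma norm_decomp: "(norm x)\<^sup>2 = (norm (p x))\<^sup>2 + (norm (x - p x))\<^sup>2"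
  unfolding power2_norm_eq_inner using inner_self[of x] by (simp add: algebra_simps inner_commute)

end

text \<open>Here \<open>p\<close>, \<open>q\<close>, \<open>e\<close> play the projections onto \<open>U\<close>, \<open>V\<close>, \<open>U \<inter> V\<close>, and \<open>c\<close>, \<open>s\<close> the cosine and
  sine of the Friedrichs angle. The optimal rate is \<open>b\<close>, and the relaxation parameter is \<open>1 + b\<close>.\<close>

locale projection_pair =
  P: orth_projection p + Q: orth_projection q + E: orth_projection e
  for p q e :: "'a::euclidean_space \<Rightarrow> 'a" +
  fixes c s b :: real
  assumes ep [simp]: "e (p x) = e x" and eq [simp]: "e (q x) = e x"
    and pe [simp]: "p (e x) = e x" and qe [simp]: "q (e x) = e x"
    and c: "0 \<le> c" "c < 1" and s: "0 \<le> s" "s\<^sup>2 = 1 - c\<^sup>2"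
    and b: "b = (1 - s) / (1 + s)"
    and angle: "\<lbrakk>p x = x; e x = 0; q y = y; e y = 0\<rbrakk> \<Longrightarrow> x \<bullet> y \<le> c * norm x * norm y"
begin

lemmas lins = P.add P.diff P.scale P.neg Q.add Q.diff Q.scale Q.neg E.add E.diff E.scale E.neg

lemma s_pos: "0 < s" "s \<le> 1"
proof -
  have "c\<^sup>2 < 1" using c by (simp add: power_less_one_iff abs_square_less_1)
  then show "0 < s" using s by (cases "s = 0") auto
  have "s\<^sup>2 \<le> 1" using s by simp
  then show "s \<le> 1" using abs_square_le_1[of s] by simp
qed

lemma b_range: "0 \<le> b" "b < 1"
  using s_pos by (simp_all add: b)

text \<open>Both follow from \<open>(1 + b) * s = 1 - b\<close>, which is how \<open>b\<close> is
  tuned to the angle: the left sides become \<open>1 + b^2 - (1 - b)^2\<close> and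
  \<open>(1 + b)^2 - (1 - b)^2\<close>.\<close>

lemma parameter_identities: "1 + b\<^sup>2 - (1 + b)\<^sup>2 * s\<^sup>2 = 2 * b" "(1 + b)\<^sup>2 * c\<^sup>2 = 4 * b"
proof -
  have *: "1 + s \<noteq> 0" "c\<^sup>2 = 1 - s\<^sup>2" using s_pos s by auto
  show "1 + b\<^sup>2 - (1 + b)\<^sup>2 * s\<^sup>2 = 2 * b"
    using *(1) by (simp add: b divide_simps) (simp add: power2_eq_square algebra_simps)
  show "(1 + b)\<^sup>2 * c\<^sup>2 = 4 * b"
    unfolding *(2) using *(1) by (simp add: b divide_simps) (simp add: power2_eq_square algebra_simps)
qed

section \<open>The relaxed projections and their quadratic recurrence\<close>

definition A where "A x = (1 + b) *\<^sub>R p x - b *\<^sub>R x"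
definition B where "B x = (1 + b) *\<^sub>R q x - b *\<^sub>R x"
definition T where "T x = A (B x)"
text \<open>This is the square of \<open>p - q\<close>, an operator that commutes with both
  projections.\<close>

definition D where "D x = p (p x - q x) - q (p x - q x)"
definition K where "K x = (1 + b\<^sup>2) *\<^sub>R x - (1 + b)\<^sup>2 *\<^sub>R D x"
text \<open>The summands \<open>u\<close> and \<open>v\<close> are taken orthogonal to the
  intersection, so that \<open>angle\<close> applies to each such pair.\<close>

definition X where "X = {u + v |u v. p u = u \<and> e u = 0 \<and> q v = v \<and> e v = 0}"

text \<open>This is Cayley-Hamilton on the plane of a pair of principal vectors: \<open>A\<close>
  and \<open>B\<close> have determinant \<open>- b\<close> there, and \<open>K\<close> acts as the
  trace of \<open>T\<close>. Written with \<open>(p - q)^2\<close> it is an identity between two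
  idempotents, so the planes need not be constructed.\<close>

lemma recurrence: "T (T x) = K (T x) - b\<^sup>2 *\<^sub>R x"
  unfolding T_def A_def B_def K_def D_def
  by (rule eq_if_inner_eq, simp add: lins inner_diff_left inner_add_left)
    (simp add: algebra_simps power2_eq_square)

lemma linear_T: "linear T"
  unfolding T_def A_def B_def by (rule linearI) (simp_all add: lins algebra_simps)

lemma linear_K: "linear K"
  unfolding K_def D_def by (rule linearI) (simp_all add: lins algebra_simps)

lemma K_sym: "K x \<bullet> y = x \<bullet> K y"
  by (simp add: K_def D_def inner_diff_left inner_diff_right lins P.sym Q.sym)

section \<open>Norm bounds for the difference of the projections\<close>

lemma D_form: "D x \<bullet> x = (norm (p x - q x))\<^sup>2"
  by (simp add: D_def power2_norm_eq_inner inner_diff_left inner_diff_right P.sym Q.sym)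

text \<open>Apply \<open>angle\<close> to \<open>u\<close> and \<open>q u\<close>: since
  \<open>u\<close> and \<open>q u\<close> have inner product \<open>norm (q u)^2\<close>, one factor
  \<open>norm (q u)\<close> cancels. The other half is symmetric.\<close>

lemma contraction:
  "p u = u \<Longrightarrow> e u = 0 \<Longrightarrow> norm (q u) \<le> c * norm u"
  "q v = v \<Longrightarrow> e v = 0 \<Longrightarrow> norm (p v) \<le> c * norm v"
proof -
  have *: "n \<le> c * m" if "n * n \<le> c * m * n" "0 \<le> n" "0 \<le> m" for n m :: real
    using that c by (cases "n = 0") (auto)
  show "norm (q u) \<le> c * norm u" if "p u = u" "e u = 0"
    using angle[OF that, of "q u"] that
    by (intro *) (auto simp: Q.inner_self[symmetric] inner_commute[of u] dot_square_norm power2_eq_square)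
  show "norm (p v) \<le> c * norm v" if "q v = v" "e v = 0"
    using angle[of "p v" v] that
    by (intro *) (auto simp: P.inner_self[symmetric] dot_square_norm power2_eq_square algebra_simps)
qed

lemma contraction_compl:
  "p u = u \<Longrightarrow> e u = 0 \<Longrightarrow> s\<^sup>2 * (norm u)\<^sup>2 \<le> (norm (u - q u))\<^sup>2"
  "q v = v \<Longrightarrow> e v = 0 \<Longrightarrow> s\<^sup>2 * (norm v)\<^sup>2 \<le> (norm (v - p v))\<^sup>2"
  using Q.norm_decomp[of u] power_mono[OF contraction(1)[of u], of 2]
    P.norm_decomp[of v] power_mono[OF contraction(2)[of v], of 2]
  by (simp_all add: s power_mult_distrib algebra_simps)

text \<open>Since \<open>p - q = (1 - q) p - q (1 - p)\<close> and the two terms have orthogonal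
  ranges, the parts \<open>p x\<close> and \<open>x - p x\<close> can be estimated
  separately.\<close>

lemma norm_diff_decomp:
  "(norm (p x - q x))\<^sup>2 = (norm (p x - q (p x)))\<^sup>2 + (norm (q (x - p x)))\<^sup>2"
proof -
  have "p x - q x = (p x - q (p x)) - q (x - p x)" by (simp add: lins)
  moreover have "(p x - q (p x)) \<bullet> q (x - p x) = 0" using Q.orth by (simp only: inner_commute)
  ultimately show ?thesis by (simp only: norm_diff_orthogonal)
qed

lemma norm_diff_le: "norm (p x - q x) \<le> norm x"
proof -
  have "(norm (p x - q (p x)))\<^sup>2 \<le> (norm (p x))\<^sup>2"
    using Q.norm_decomp[of "p x"] by simp
  moreover have "(norm (q (x - p x)))\<^sup>2 \<le> (norm (x - p x))\<^sup>2"
    by (simp add: Q.norm_le power_mono)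
  ultimately have "(norm (p x - q x))\<^sup>2 \<le> (norm x)\<^sup>2"
    using norm_diff_decomp[of x] P.norm_decomp[of x] by linarith
  then show ?thesis by (simp add: power2_le_iff_abs_le)
qed

text \<open>The part \<open>p x\<close> is covered by \<open>contraction_compl\<close>. The other
  part is \<open>r = v - p v\<close>, the component of \<open>v\<close> orthogonal to the range of
  \<open>p\<close>; combining \<open>norm r^2 \<le> norm (q r) * norm v\<close> with
  \<open>s * norm v \<le> norm r\<close> gives \<open>s * norm r \<le> norm (q r)\<close>.\<close>

lemma norm_diff_ge:
  assumes "x \<in> X" shows "s\<^sup>2 * (norm x)\<^sup>2 \<le> (norm (p x - q x))\<^sup>2"
proof -
  obtain u v where uv: "x = u + v" "p u = u" "e u = 0" "q v = v" "e v = 0"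
    using assms by (auto simp: X_def)
  have ex: "e x = 0" by (simp add: uv lins)
  define r where "r = x - p x"
  have r: "r = v - p v" by (simp add: r_def uv lins)
  have "r \<bullet> p v = 0" using P.orth[of v v] by (simp add: r inner_commute)
  then have "(norm r)\<^sup>2 = r \<bullet> v"
    unfolding power2_norm_eq_inner by (simp add: r inner_diff_right inner_commute)
  also have "\<dots> = q r \<bullet> v" using uv by (simp add: Q.sym)
  also have "\<dots> \<le> norm (q r) * norm v" by (rule norm_cauchy_schwarz)
  finally have 1: "s * (norm r)\<^sup>2 \<le> norm (q r) * (s * norm v)"
    using s_pos by (simp add: mult_left_mono mult.left_commute)
  have "(s * norm v)\<^sup>2 \<le> (norm r)\<^sup>2"
    using contraction_compl(2)[OF uv(4,5)] by (simp add: r power_mult_distrib)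
  then have "s * norm v \<le> norm r" by (rule power2_le_imp_le) simp
  then have "s * (norm r)\<^sup>2 \<le> norm (q r) * norm r"
    using 1 by (meson mult_left_mono norm_ge_zero order_trans)
  then have "s * norm r \<le> norm (q r)"
    by (cases "r = 0") (auto simp: power2_eq_square)
  then have "s\<^sup>2 * (norm r)\<^sup>2 \<le> (norm (q r))\<^sup>2"
    using s by (metis mult_nonneg_nonneg norm_ge_zero power_mono power_mult_distrib)
  moreover have "s\<^sup>2 * (norm (p x))\<^sup>2 \<le> (norm (p x - q (p x)))\<^sup>2"
    using ex by (intro contraction_compl) auto
  ultimately show ?thesis
    using norm_diff_decomp[of x] P.norm_decomp[of x] by (simp add: r_def algebra_simps)
qed

section \<open>The invariant subspace \<open>X\<close> and the norm of \<open>K\<close> on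
  it\<close>

lemma X_I: "\<lbrakk>p u = u; e u = 0; q v = v; e v = 0\<rbrakk> \<Longrightarrow> u + v \<in> X"
  by (auto simp: X_def)

lemma subspace_X: "subspace X"
proof (rule subspaceI)
  show "0 \<in> X" using X_I[of 0 0] by simp
next
  fix x y assume "x \<in> X" "y \<in> X"
  then obtain u v u' v' where "x = u + v" "p u = u" "e u = 0" "q v = v" "e v = 0"
    "y = u' + v'" "p u' = u'" "e u' = 0" "q v' = v'" "e v' = 0"
    by (auto simp: X_def)
  then show "x + y \<in> X" using X_I[of "u + u'" "v + v'"] by (simp add: lins algebra_simps)
next
  fix r x assume "x \<in> X"
  then obtain u v where "x = u + v" "p u = u" "e u = 0" "q v = v" "e v = 0"
    by (auto simp: X_def)
  then show "r *\<^sub>R x \<in> X" using X_I[of "r *\<^sub>R u" "r *\<^sub>R v"] by (simp add: lins algebra_simps)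
qed

lemma e_X: "x \<in> X \<Longrightarrow> e x = 0"
  by (auto simp: X_def lins)

lemma pq_X: "e x = 0 \<Longrightarrow> p x \<in> X" "e x = 0 \<Longrightarrow> q x \<in> X"
  using X_I[of "p x" 0] X_I[of 0 "q x"] by simp_all

lemma D_X: "D x \<in> X"
  unfolding D_def by (intro subspace_diff[OF subspace_X] pq_X) (simp_all add: lins)

lemma K_X: "x \<in> X \<Longrightarrow> K x \<in> X"
  unfolding K_def by (intro subspace_diff[OF subspace_X] subspace_scale[OF subspace_X] D_X)

lemma T_X: "x \<in> X \<Longrightarrow> T x \<in> X"
proof -
  have A: "A x \<in> X" if "x \<in> X" for x
    unfolding A_def
    by (intro subspace_diff[OF subspace_X] subspace_scale[OF subspace_X] pq_X that e_X)
  have B: "B x \<in> X" if "x \<in> X" for x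
    unfolding B_def
    by (intro subspace_diff[OF subspace_X] subspace_scale[OF subspace_X] pq_X that e_X)
  show "x \<in> X \<Longrightarrow> T x \<in> X" by (simp add: A B T_def)
qed

lemma K_form:
  assumes "x \<in> X" shows "\<bar>K x \<bullet> x\<bar> \<le> 2 * b * (norm x)\<^sup>2"
proof -
  have *: "K x \<bullet> x = (1 + b\<^sup>2) * (norm x)\<^sup>2 - (1 + b)\<^sup>2 * (norm (p x - q x))\<^sup>2"
    by (simp add: K_def inner_diff_left D_form dot_square_norm)
  have "K x \<bullet> x \<le> (1 + b\<^sup>2) * (norm x)\<^sup>2 - (1 + b)\<^sup>2 * (s\<^sup>2 * (norm x)\<^sup>2)"
    unfolding * using norm_diff_ge[OF assms] by (simp add: mult_left_mono)
  also have "\<dots> = (1 + b\<^sup>2 - (1 + b)\<^sup>2 * s\<^sup>2) * (norm x)\<^sup>2" by (simp add: algebra_simps)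
  finally have 1: "K x \<bullet> x \<le> 2 * b * (norm x)\<^sup>2" by (simp add: parameter_identities)
  \<comment> \<open>The other end of the range of \<open>D\<close> gives the same bound with
    opposite sign, because \<open>1 + b^2 - (1 + b)^2 = - 2 * b\<close>.\<close>
  have "(norm (p x - q x))\<^sup>2 \<le> (norm x)\<^sup>2" by (simp add: norm_diff_le power_mono)
  then have "K x \<bullet> x \<ge> (1 + b\<^sup>2) * (norm x)\<^sup>2 - (1 + b)\<^sup>2 * (norm x)\<^sup>2"
    unfolding * by (simp add: mult_left_mono)
  then have "- (2 * b * (norm x)\<^sup>2) \<le> K x \<bullet> x"
    by (simp add: power2_sum algebra_simps)
  then show ?thesis using 1 by simp
qed

text \<open>For a symmetric operator a bound on the quadratic form bounds the norm: polarize with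
  \<open>y\<close>, the vector of the length of \<open>x\<close> in the direction of
  \<open>K x\<close>, and use the parallelogram law.\<close>

lemma norm_K_le:
  assumes x: "x \<in> X" shows "norm (K x) \<le> 2 * b * norm x"
proof (cases "x = 0 \<or> K x = 0")
  case True
  then show ?thesis using b_range linear_0[OF linear_K] by auto
next
  case False
  define y where "y = (norm x / norm (K x)) *\<^sub>R K x"
  have y: "y \<in> X" "norm y = norm x"
    using False by (auto simp: y_def subspace_scale[OF subspace_X] K_X x)
  have "K x \<bullet> y = norm x * norm (K x)"
    by (simp add: y_def dot_square_norm power2_eq_square)
  moreover have "4 * (K x \<bullet> y) = K (x + y) \<bullet> (x + y) - K (x - y) \<bullet> (x - y)"
    using K_sym[of x y]
    by (simp add: linear_add[OF linear_K] linear_diff[OF linear_K] algebra_simps inner_commute)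
  moreover have "\<dots> \<le> 2 * b * (norm (x + y))\<^sup>2 + 2 * b * (norm (x - y))\<^sup>2"
    using K_form[of "x + y"] K_form[of "x - y"] x y(1)
      subspace_add[OF subspace_X x y(1)] subspace_diff[OF subspace_X x y(1)] by linarith
  moreover have "(norm (x + y))\<^sup>2 + (norm (x - y))\<^sup>2 = 2 * (norm x)\<^sup>2 + 2 * (norm y)\<^sup>2"
    by (simp add: power2_norm_eq_inner algebra_simps)
  ultimately have "4 * (norm x * norm (K x)) \<le> 2 * b * (4 * (norm x)\<^sup>2)"
    using y(2) by (simp add: distrib_left[symmetric] del: distrib_left_numeral)
  then show ?thesis using False by (simp add: power2_eq_square)
qed

text \<open>Each relaxed projection fixes the range of its projection and multiplies the orthogonal
  complement by \<open>- b\<close>.\<close>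

lemma norm_T_le: "norm (T x) \<le> norm x"
proof -
  have *: "norm ((1 + b) *\<^sub>R f x - b *\<^sub>R x) \<le> norm x" if "orth_projection f" for f and x :: 'a
  proof -
    interpret f: orth_projection f by fact
    have "(1 + b) *\<^sub>R f x - b *\<^sub>R x = f x - b *\<^sub>R (x - f x)" by (simp add: algebra_simps)
    moreover have "f x \<bullet> (x - f x) = 0" by (rule f.orth)
    ultimately have "(norm ((1 + b) *\<^sub>R f x - b *\<^sub>R x))\<^sup>2 = (norm (f x))\<^sup>2 + b\<^sup>2 * (norm (x - f x))\<^sup>2"
      using norm_diff_orthogonal[of "f x" "b *\<^sub>R (x - f x)"] by (simp add: power_mult_distrib)
    also have "\<dots> \<le> (norm (f x))\<^sup>2 + 1 * (norm (x - f x))\<^sup>2"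
      using b_range by (intro add_mono mult_right_mono) (auto simp: power_le_one)
    also have "\<dots> = (norm x)\<^sup>2" using f.norm_decomp[of x] by simp
    finally show ?thesis by (rule power2_le_imp_le) simp
  qed
  show ?thesis unfolding T_def A_def B_def
    using *[OF P.orth_projection_axioms] *[OF Q.orth_projection_axioms] order_trans by blast
qed

section \<open>Decay of the iterates and convergence\<close>

lemma funpow_T_X: "x \<in> X \<Longrightarrow> (T ^^ k) x \<in> X"
  by (induction k) (auto simp: T_X)

text \<open>The energy \<open>F k\<close> in the proof is the positive semidefinite quadratic form that the recurrence
  scales by \<open>b\<^sup>2\<close>; it controls the distance of each iterate to \<open>K/2\<close> times the previous one.\<close>

lemma decay_X:
  assumes x: "x \<in> X" and \<mu>: "b < \<mu>" "\<mu> < 1"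
  shows "norm ((T ^^ k) x) \<le> 2 / (\<mu> - b) * \<mu> ^ k * norm x"
proof -
  define w where "w k = (T ^^ k) x" for k
  define F where "F k = w (Suc k) \<bullet> w (Suc k) - K (w (Suc k)) \<bullet> w k + b\<^sup>2 * (w k \<bullet> w k)" for k
  have wX: "w k \<in> X" for k by (simp add: w_def funpow_T_X x)
  have w2: "w (Suc (Suc k)) = K (w (Suc k)) - b\<^sup>2 *\<^sub>R w k" for k
    by (simp add: w_def recurrence)
  have F_Suc: "F (Suc k) = b\<^sup>2 * F k" for k
  proof -
    have "F (Suc k) = w (Suc (Suc k)) \<bullet> (w (Suc (Suc k)) - K (w (Suc k))) + b\<^sup>2 * (w (Suc k) \<bullet> w (Suc k))"
      by (simp add: F_def inner_diff_right K_sym)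
    also have "\<dots> = b\<^sup>2 * F k"
      by (simp add: w2 F_def inner_diff_left algebra_simps)
    finally show ?thesis .
  qed
  have "F 0 \<le> norm x * norm x + 2 * b * norm x * norm x + b\<^sup>2 * (norm x * norm x)"
  proof -
    have "w 1 \<bullet> w 1 \<le> norm x * norm x"
      using mult_mono[OF norm_T_le norm_T_le, of x x] by (simp add: w_def dot_square_norm power2_eq_square)
    moreover have "- (K (w 1) \<bullet> w 0) \<le> 2 * b * norm x * norm x"
    proof -
      have "- (K (w 1) \<bullet> w 0) \<le> norm (K (w 1)) * norm x"
        using norm_cauchy_schwarz[of "- K (w 1)" "w 0"] by (simp add: w_def)
      also have "norm (K (w 1)) \<le> 2 * b * norm x"
        using norm_K_le[OF wX[of 1]] mult_left_mono[OF norm_T_le[of x], of "2 * b"] b_range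
        by (simp add: w_def)
      finally show ?thesis by (simp add: mult_right_mono)
    qed
    ultimately show ?thesis
      by (simp add: F_def) (simp add: w_def dot_square_norm power2_eq_square)
  qed
  also have "\<dots> = (1 + b)\<^sup>2 * (norm x)\<^sup>2"
    by (simp add: power2_eq_square algebra_simps)
  also have "\<dots> \<le> 2\<^sup>2 * (norm x)\<^sup>2"
    using b_range by (intro mult_right_mono power_mono) auto
  finally have F0: "F 0 \<le> (2 * norm x)\<^sup>2" by (simp add: power_mult_distrib)
  have F: "F k = (b ^ k)\<^sup>2 * F 0" for k
    by (induction k) (simp_all add: F_Suc power_mult_distrib)
  \<comment> \<open>Complete the square in \<open>F k\<close>; the remainder is nonnegative by
    \<open>norm_K_le\<close>.\<close>
  have half: "norm (w (Suc k) - (1/2) *\<^sub>R K (w k)) \<le> 2 * b ^ k * norm x" for k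
  proof -
    have "(norm (K (w k)))\<^sup>2 \<le> (2 * b * norm (w k))\<^sup>2"
      by (intro power_mono norm_K_le wX) auto
    moreover have "F k = (norm (w (Suc k) - (1/2) *\<^sub>R K (w k)))\<^sup>2
        + (b\<^sup>2 * (norm (w k))\<^sup>2 - (norm (K (w k)))\<^sup>2 / 4)"
      using K_sym[of "w (Suc k)" "w k"] unfolding F_def power2_norm_eq_inner
      by (simp add: inner_diff_left inner_diff_right inner_commute field_simps)
    ultimately have "(norm (w (Suc k) - (1/2) *\<^sub>R K (w k)))\<^sup>2 \<le> F k"
      by (simp add: power_mult_distrib)
    also have "\<dots> \<le> (b ^ k)\<^sup>2 * (2 * norm x)\<^sup>2"
      unfolding F[of k] by (intro mult_left_mono F0) auto
    also have "\<dots> = (2 * b ^ k * norm x)\<^sup>2" by (simp add: power_mult_distrib)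
    finally show ?thesis by (rule power2_le_imp_le) (use b_range in simp)
  qed
  \<comment> \<open>The constant \<open>C = 2 / (\<mu> - b)\<close> solves
    \<open>b * C + 2 = \<mu> * C\<close>, which closes the induction; the gap between
    \<open>b\<close> and \<open>\<mu>\<close> absorbs the factor \<open>k\<close> of a double
    root.\<close>
  have "norm (w k) \<le> 2 / (\<mu> - b) * \<mu> ^ k * norm x"
  proof (induction k)
    case 0
    have "1 \<le> 2 / (\<mu> - b)" using \<mu> b_range by (simp add: field_simps)
    then show ?case using mult_right_mono[of 1 "2 / (\<mu> - b)" "norm x"] by (simp add: w_def)
  next
    case (Suc k)
    have "norm (w (Suc k)) \<le> norm ((1/2) *\<^sub>R K (w k)) + norm (w (Suc k) - (1/2) *\<^sub>R K (w k))"
      by (metis add.commute diff_add_cancel norm_triangle_ineq)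
    also have "\<dots> \<le> b * norm (w k) + 2 * b ^ k * norm x"
      using norm_K_le[OF wX[of k]] half[of k] by simp
    also have "\<dots> \<le> b * (2 / (\<mu> - b) * \<mu> ^ k * norm x) + 2 * \<mu> ^ k * norm x"
      using Suc \<mu> b_range by (intro add_mono mult_left_mono mult_right_mono power_mono) auto
    also have "\<dots> = 2 / (\<mu> - b) * \<mu> ^ Suc k * norm x"
      using \<mu> by (simp add: field_simps)
    finally show ?case .
  qed
  then show ?thesis by (simp add: w_def)
qed

lemma convergence:
  assumes \<mu>: "b < \<mu>" "\<mu> < 1"
  shows "norm ((T ^^ k) x - e x) \<le> (1 + 2 / (\<mu> - b)) * \<mu> ^ k * norm x"
proof -
  \<comment> \<open>\<open>g\<close> is the component of \<open>x\<close> in the sum of the two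
    ranges, \<open>h\<close> the one orthogonal to both.\<close>
  obtain g h where gh: "x = g + h" "g \<in> span (range p \<union> range q)"
    "\<And>w. w \<in> span (range p \<union> range q) \<Longrightarrow> orthogonal h w"
    using orthogonal_subspace_decomp_exists[of "range p \<union> range q" x] by metis
  have "h \<bullet> p h = 0" "h \<bullet> q h = 0"
    using gh(3)[of "p h"] gh(3)[of "q h"] by (auto simp: orthogonal_def span_base)
  then have h: "p h = 0" "q h = 0"
    using P.inner_self[of h] Q.inner_self[of h] by (simp_all add: inner_commute)
  have eh: "e h = 0" by (metis ep h(1) E.zero)
  have orth: "g \<bullet> h = 0" using gh(2,3) by (simp add: orthogonal_def inner_commute)
  then have "(norm x)\<^sup>2 = (norm g)\<^sup>2 + (norm h)\<^sup>2"
    by (simp add: gh(1) power2_norm_eq_inner algebra_simps inner_commute)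
  then have "(norm g)\<^sup>2 \<le> (norm x)\<^sup>2" "(norm h)\<^sup>2 \<le> (norm x)\<^sup>2" by simp_all
  then have le: "norm g \<le> norm x" "norm h \<le> norm x" by (simp_all add: power2_le_iff_abs_le)
  have "subspace (range p)" "subspace (range q)"
    by (simp_all add: linear_subspace_image P.lin Q.lin)
  then have "g \<in> {x + y |x y. x \<in> range p \<and> y \<in> range q}"
    using gh(2) by (simp add: span_Un span_eq_iff[THEN iffD2])
  then obtain u v where uv: "g = p u + q v" by auto
  \<comment> \<open>Since \<open>e g = e u + e v\<close>, each summand of \<open>g\<close> can be
    reduced by its own share.\<close>
  have gX: "g - e g \<in> X"
    using X_I[of "p u - e u" "q v - e v"] by (simp add: uv lins algebra_simps)
  have Te: "(T ^^ k) (e x) = e x"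
    by (induction k) (simp_all add: T_def A_def B_def lins algebra_simps)
  have Th: "(T ^^ k) h = (b\<^sup>2) ^ k *\<^sub>R h"
    by (induction k) (simp_all add: linear_scale[OF linear_T], simp add: T_def A_def B_def lins h power2_eq_square algebra_simps)
  have lk: "linear (T ^^ k)"
    by (induction k) (simp_all only: funpow.simps linear_id linear_compose linear_T)
  have "x = e x + (g - e g) + h" by (simp add: gh(1) lins eh)
  then have "(T ^^ k) x = e x + (T ^^ k) (g - e g) + (b\<^sup>2) ^ k *\<^sub>R h"
    by (metis Te Th linear_add[OF lk])
  then have "norm ((T ^^ k) x - e x) \<le> norm ((b\<^sup>2) ^ k *\<^sub>R h) + norm ((T ^^ k) (g - e g))"
    using norm_triangle_ineq[of "(b\<^sup>2) ^ k *\<^sub>R h" "(T ^^ k) (g - e g)"] by (simp add: add.commute)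
  also have "\<dots> \<le> \<mu> ^ k * norm x + 2 / (\<mu> - b) * \<mu> ^ k * norm x"
  proof (rule add_mono)
    have "b\<^sup>2 \<le> b * 1" unfolding power2_eq_square using b_range by (intro mult_left_mono) auto
    then have "(b\<^sup>2) ^ k \<le> \<mu> ^ k" using \<mu> by (intro power_mono) auto
    then show "norm ((b\<^sup>2) ^ k *\<^sub>R h) \<le> \<mu> ^ k * norm x"
      using le b_range \<mu> by (auto intro!: mult_mono)
    have "(norm (g - e g))\<^sup>2 \<le> (norm g)\<^sup>2" using E.norm_decomp[of g] by simp
    then have "norm (g - e g) \<le> norm x" using le by (simp add: power2_le_iff_abs_le)
    then show "norm ((T ^^ k) (g - e g)) \<le> 2 / (\<mu> - b) * \<mu> ^ k * norm x"
      using \<mu> b_range by (intro order_trans[OF decay_X[OF gX \<mu>]] mult_left_mono) auto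
  qed
  finally show ?thesis by (simp add: algebra_simps)
qed

section \<open>Eigenvalues\<close>

text \<open>The vectors \<open>x\<close> and \<open>y\<close> are the real and imaginary part of an eigenvector
  for the eigenvalue \<open>l + \<i> m\<close>.\<close>

lemma eigenvalue_modulus:
  assumes Tx: "T x = l *\<^sub>R x - m *\<^sub>R y" and Ty: "T y = m *\<^sub>R x + l *\<^sub>R y"
    and nz: "x \<noteq> 0 \<or> y \<noteq> 0"
  shows "l\<^sup>2 + m\<^sup>2 \<in> {0, b\<^sup>2, (b\<^sup>2)\<^sup>2} \<or> (l = 1 \<and> m = 0)"
proof -
  define N where "N = l\<^sup>2 + m\<^sup>2"
  note lK = linear_add[OF linear_K] linear_diff[OF linear_K] linear_scale[OF linear_K]
  note lT = linear_add[OF linear_T] linear_diff[OF linear_T] linear_scale[OF linear_T]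
  \<comment> \<open>With \<open>z = x + i y\<close> and eigenvalue \<open>t = l + i m\<close>, the
    recurrence reads \<open>t K z = (t^2 + b^2) z\<close>. Facts \<open>1\<close> and
    \<open>2\<close> are its real and imaginary parts.\<close>
  have 1: "l *\<^sub>R K x - m *\<^sub>R K y = (l\<^sup>2 - m\<^sup>2 + b\<^sup>2) *\<^sub>R x - (2 * l * m) *\<^sub>R y"
  proof (rule eq_if_inner_eq)
    fix w
    show "(l *\<^sub>R K x - m *\<^sub>R K y) \<bullet> w = ((l\<^sup>2 - m\<^sup>2 + b\<^sup>2) *\<^sub>R x - (2 * l * m) *\<^sub>R y) \<bullet> w"
      using arg_cong[OF recurrence[of x], of "\<lambda>z. z \<bullet> w"] unfolding Tx lT lK Ty
      by (simp add: inner_diff_left inner_add_left) (simp add: algebra_simps power2_eq_square)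
  qed
  have 2: "m *\<^sub>R K x + l *\<^sub>R K y = (l\<^sup>2 - m\<^sup>2 + b\<^sup>2) *\<^sub>R y + (2 * l * m) *\<^sub>R x"
  proof (rule eq_if_inner_eq)
    fix w
    show "(m *\<^sub>R K x + l *\<^sub>R K y) \<bullet> w = ((l\<^sup>2 - m\<^sup>2 + b\<^sup>2) *\<^sub>R y + (2 * l * m) *\<^sub>R x) \<bullet> w"
      using arg_cong[OF recurrence[of y], of "\<lambda>z. z \<bullet> w"] unfolding Ty lT lK Tx
      by (simp add: inner_diff_left inner_add_left) (simp add: algebra_simps power2_eq_square)
  qed
  \<comment> \<open>Multiplying by the conjugate of \<open>t\<close> isolates \<open>K\<close>, as
    \<open>N\<close> is the squared modulus of \<open>t\<close>.\<close>
  have Kx: "N *\<^sub>R K x = (l * (N + b\<^sup>2)) *\<^sub>R x + (m * (b\<^sup>2 - N)) *\<^sub>R y"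
  proof -
    have "N *\<^sub>R K x = l *\<^sub>R (l *\<^sub>R K x - m *\<^sub>R K y) + m *\<^sub>R (m *\<^sub>R K x + l *\<^sub>R K y)"
      by (simp add: N_def algebra_simps power2_eq_square)
    also have "\<dots> = (l * (N + b\<^sup>2)) *\<^sub>R x + (m * (b\<^sup>2 - N)) *\<^sub>R y"
      unfolding 1 2 N_def
      by (rule eq_if_inner_eq, simp only: inner_diff_left inner_add_left inner_scaleR_left)
        (simp add: algebra_simps power2_eq_square)
    finally show ?thesis .
  qed
  have Ky: "N *\<^sub>R K y = (l * (N + b\<^sup>2)) *\<^sub>R y - (m * (b\<^sup>2 - N)) *\<^sub>R x"
  proof -
    have "N *\<^sub>R K y = l *\<^sub>R (m *\<^sub>R K x + l *\<^sub>R K y) - m *\<^sub>R (l *\<^sub>R K x - m *\<^sub>R K y)"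
      by (simp add: N_def algebra_simps power2_eq_square)
    also have "\<dots> = (l * (N + b\<^sup>2)) *\<^sub>R y - (m * (b\<^sup>2 - N)) *\<^sub>R x"
      unfolding 1 2 N_def
      by (rule eq_if_inner_eq, simp only: inner_diff_left inner_add_left inner_scaleR_left)
        (simp add: algebra_simps power2_eq_square)
    finally show ?thesis .
  qed
  \<comment> \<open>The symmetric \<open>K\<close> has only real eigenvalues, so the imaginary
    coefficient must vanish: either \<open>t\<close> has modulus \<open>b\<close> or it is
    real.\<close>
  have "(N *\<^sub>R K x) \<bullet> y = x \<bullet> (N *\<^sub>R K y)" by (simp add: K_sym)
  then have "m * (b\<^sup>2 - N) * (x \<bullet> x + y \<bullet> y) = 0"
    unfolding Kx Ky by (simp add: algebra_simps)
  moreover have "x \<bullet> x + y \<bullet> y \<noteq> 0"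
    using nz by (simp add: add_nonneg_eq_0_iff)
  ultimately consider "N = b\<^sup>2" | "m = 0" by auto
  then show ?thesis
  proof cases
    case 1
    then show ?thesis by (simp add: N_def)
  next
    case 2
    obtain w where w: "w \<noteq> 0" "N *\<^sub>R K w = (l * (N + b\<^sup>2)) *\<^sub>R w"
      using nz Kx Ky 2 by auto
    show ?thesis
    proof (cases "l = 0 \<or> l = 1 \<or> l = b\<^sup>2")
      case True
      then show ?thesis using 2 by auto
    next
      case False
      have "l *\<^sub>R (l *\<^sub>R K w) = l *\<^sub>R ((l\<^sup>2 + b\<^sup>2) *\<^sub>R w)"
        using w(2) 2 by (simp add: N_def power2_eq_square)
      then have Kw: "l *\<^sub>R K w = (l\<^sup>2 + b\<^sup>2) *\<^sub>R w"
        using False by (simp only: scaleR_cancel_left) simp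
      \<comment> \<open>Outside the excluded values of \<open>l\<close>, this makes \<open>w\<close>
        a multiple of \<open>D w\<close>, hence an element of \<open>X\<close>, where the bound on
        \<open>K\<close> is available.\<close>
      have "((1 - l) * (l - b\<^sup>2)) *\<^sub>R w = (l * (1 + b\<^sup>2)) *\<^sub>R w - (l\<^sup>2 + b\<^sup>2) *\<^sub>R w"
        by (simp add: algebra_simps power2_eq_square)
      also have "\<dots> = (l * (1 + b)\<^sup>2) *\<^sub>R D w"
        unfolding Kw[symmetric] by (simp add: K_def algebra_simps)
      finally have "((1 - l) * (l - b\<^sup>2)) *\<^sub>R w \<in> X"
        by (simp only: D_X subspace_scale[OF subspace_X])
      then have "(1 / ((1 - l) * (l - b\<^sup>2))) *\<^sub>R ((1 - l) * (l - b\<^sup>2)) *\<^sub>R w \<in> X"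
        by (rule subspace_scale[OF subspace_X])
      moreover have "(1 - l) * (l - b\<^sup>2) \<noteq> 0" using False by simp
      ultimately have "w \<in> X" by (simp only: scaleR_scaleR) simp
      then have "\<bar>l\<bar> * norm (K w) \<le> \<bar>l\<bar> * (2 * b * norm w)"
        by (intro mult_left_mono norm_K_le) auto
      moreover have "\<bar>l\<bar> * norm (K w) = (l\<^sup>2 + b\<^sup>2) * norm w"
        using arg_cong[OF Kw, of norm] by simp
      ultimately have "l\<^sup>2 + b\<^sup>2 \<le> \<bar>l\<bar> * 2 * b"
        using w(1) by simp
      then have "(\<bar>l\<bar> - b)\<^sup>2 \<le> 0" by (simp add: power2_diff)
      then have "\<bar>l\<bar> = b" by simp
      then show ?thesis using 2 by auto
    qed
  qed
qed

text \<open>On the plane spanned by an optimal pair \<open>x\<close>, \<open>y\<close>, the operator \<open>T\<close> has the double eigenvalue \<open>b\<close>.\<close>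

lemma eigenvector_b:
  assumes x: "p x = x" "e x = 0" "norm x = 1" and y: "q y = y" "e y = 0" "norm y = 1"
    and xy: "x \<bullet> y = c" and b0: "b \<noteq> 0"
  obtains z where "z \<noteq> 0" "T z = b *\<^sub>R z"
proof -
  have 1: "x \<bullet> x = 1" "y \<bullet> y = 1" using x y by (simp_all add: dot_square_norm)
  \<comment> \<open>The equality case of Cauchy-Schwarz; it identifies the projections of
    \<open>x\<close> and \<open>y\<close>.\<close>
  have *: "z = c *\<^sub>R w" if "norm z \<le> c" "w \<bullet> z = c" "w \<bullet> w = 1" for w z :: 'a
  proof -
    have "(norm z)\<^sup>2 \<le> c\<^sup>2" using that(1) by (simp add: power_mono)
    then have "(norm (z - c *\<^sub>R w))\<^sup>2 \<le> 0"
      using that(2,3) unfolding power2_norm_eq_inner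
      by (simp add: inner_diff_left inner_diff_right inner_commute power2_eq_square)
    then show ?thesis by simp
  qed
  have py: "p y = c *\<^sub>R x"
    using contraction(2)[of y] x y xy 1 by (intro *) (auto simp flip: P.sym)
  have qx: "q x = c *\<^sub>R y"
    using contraction(1)[of x] x y xy 1 by (intro *) (auto simp: inner_commute simp flip: Q.sym)
  \<comment> \<open>This is \<open>T y - b y\<close>. As \<open>K\<close> is \<open>2 * b\<close> on
    the plane, \<open>T - b\<close> squares to zero there and so annihilates
    \<open>z\<close>.\<close>
  define z where "z = ((1 + b) * c) *\<^sub>R x - (2 * b) *\<^sub>R y"
  have "T z = ((1 + b) * c * ((1 + b)\<^sup>2 * c\<^sup>2) - b * ((1 + b) * c) - 2 * b * ((1 + b) * c)) *\<^sub>R x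
      + (2 * b\<^sup>2 - b * ((1 + b)\<^sup>2 * c\<^sup>2)) *\<^sub>R y"
    unfolding T_def A_def B_def z_def
    by (rule eq_if_inner_eq, simp add: lins x y py qx inner_diff_left inner_add_left)
      (simp add: algebra_simps power2_eq_square)
  also have "\<dots> = b *\<^sub>R z"
    unfolding parameter_identities z_def by (simp add: algebra_simps power2_eq_square)
  finally have Tz: "T z = b *\<^sub>R z" .
  have "z \<bullet> z = (1 + b)\<^sup>2 * c\<^sup>2 - 4 * b * (1 + b) * c\<^sup>2 + 4 * b\<^sup>2"
    using 1 xy unfolding z_def
    by (simp add: inner_diff_left inner_diff_right inner_commute[of y x] power2_eq_square algebra_simps)
  also have "\<dots> = 4 * b * (1 + b) * s\<^sup>2"
    unfolding parameter_identities s(2) by (simp add: power2_eq_square algebra_simps)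
  finally have "z \<noteq> 0" using b0 s_pos b_range by (auto simp:)
  then show ?thesis using Tz that by blast
qed

end

subsection \<open>Projections onto subspaces\<close>

lemma closest_point_in_subspace:
  fixes U :: "(real ^ 'n) set"
  assumes U: "subspace U"
  shows "closest_point U x \<in> U"
  using closest_point_in_set[of U x] closed_subspace[OF U] subspace_0[OF U] by blast

lemma closest_point_subspace_orthogonal:
  fixes U :: "(real ^ 'n) set"
  assumes U: "subspace U" and y: "y \<in> U"
  shows "(x - closest_point U x) \<bullet> y = 0"
proof -
  have ineq: "(x - closest_point U x) \<bullet> (y - closest_point U x) \<le> 0" if "y \<in> U" for y
    using closest_point_dot[of U y x] subspace_imp_convex[OF U] closed_subspace[OF U] that by blast
  show ?thesis
    using ineq[of "closest_point U x + y"] ineq[of "closest_point U x - y"] y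
      closest_point_in_subspace[OF U, of x] U
    by (simp add: subspace_add subspace_diff)
qed

lemma orth_projection_closest_point:
  fixes U :: "(real ^ 'n) set"
  assumes U: "subspace U"
  shows "orth_projection (closest_point U)"
proof (rule orth_projection.intro)
  show "linear (closest_point U)" by (rule linear_closest_point_subspace[OF U])
  show "closest_point U (closest_point U x) = closest_point U x" for x
    by (simp add: closest_point_in_subspace[OF U] closest_point_self)
  show "closest_point U x \<bullet> y = x \<bullet> closest_point U y" for x y
    using closest_point_subspace_orthogonal[OF U closest_point_in_subspace[OF U], of x y]
      closest_point_subspace_orthogonal[OF U closest_point_in_subspace[OF U], of y x]
    by (simp add: inner_diff_left inner_commute[of "closest_point U x"])
qed

lemma closest_point_subspace_eq_iff:
  fixes U :: "(real ^ 'n) set"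
  assumes U: "subspace U"
  shows "closest_point U x = x \<longleftrightarrow> x \<in> U"
  by (metis U closest_point_in_subspace closest_point_self)

lemma closest_point_subspace_eq_0_iff:
  fixes U :: "(real ^ 'n) set"
  assumes U: "subspace U"
  shows "closest_point U x = 0 \<longleftrightarrow> (\<forall>y\<in>U. x \<bullet> y = 0)"
proof
  show "\<forall>y\<in>U. x \<bullet> y = 0" if "closest_point U x = 0"
    using closest_point_subspace_orthogonal[OF U, of _ x] that by simp
  show "closest_point U x = 0" if "\<forall>y\<in>U. x \<bullet> y = 0"
    using closest_point_subspace_orthogonal[OF U closest_point_in_subspace[OF U], of x x]
      that closest_point_in_subspace[OF U, of x] by (simp add: inner_diff_left)
qed

lemma closest_point_smaller_subspace:
  fixes U W :: "(real ^ 'n) set"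
  assumes U: "subspace U" and W: "subspace W" "W \<subseteq> U"
  shows "closest_point W (closest_point U x) = closest_point W x"
    and "closest_point U (closest_point W x) = closest_point W x"
proof -
  interpret E: orth_projection "closest_point W" by (rule orth_projection_closest_point[OF W(1)])
  have "closest_point W (x - closest_point U x) = 0"
    unfolding closest_point_subspace_eq_0_iff[OF W(1)]
    using closest_point_subspace_orthogonal[OF U, of _ x] W(2) by auto
  then show "closest_point W (closest_point U x) = closest_point W x" by (simp add: E.diff)
  show "closest_point U (closest_point W x) = closest_point W x"
    unfolding closest_point_subspace_eq_iff[OF U] using closest_point_in_subspace[OF W(1)] W(2) by auto
qed

subsection \<open>Principal vectors and the Friedrichs angle\<close>

text \<open>\<open>A\<close> need not lie in \<open>U\<close>, so its projections to
  \<open>U\<close> are used: they span a proper subspace, and for \<open>x\<close> in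
  \<open>U\<close> orthogonality to \<open>a\<close> and to its projection agree.\<close>

lemma unit_vector_in_subspace_orthogonal_to:
  fixes U :: "(real ^ 'n) set"
  assumes U: "subspace U" and A: "finite A" "card A < dim U"
  obtains x where "x \<in> U" "norm x = 1" "\<And>a. a \<in> A \<Longrightarrow> x \<bullet> a = 0"
proof -
  interpret P: orth_projection "closest_point U" by (rule orth_projection_closest_point[OF U])
  let ?B = "closest_point U ` A"
  have sub: "span ?B \<subseteq> U"
    using closest_point_in_subspace[OF U] by (intro span_minimal U) auto
  have "dim ?B \<le> card ?B" using A(1) by (simp add: dim_le_card')
  also have "\<dots> \<le> card A" by (rule card_image_le[OF A(1)])
  finally have "dim (span ?B) \<noteq> dim U" using A(2) by simp
  then have "span ?B \<subset> U" using sub psubsetI by metis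
  then have "span ?B \<subset> span U" using U by (simp add: span_eq_iff[THEN iffD2])
  then obtain x where x: "x \<noteq> 0" "x \<in> span U" "\<And>y. y \<in> span ?B \<Longrightarrow> orthogonal x y"
    using orthogonal_to_subspace_exists_gen by blast
  have xU: "x \<in> U" using x(2) U by (simp add: span_eq_iff[THEN iffD2])
  have "x \<bullet> a = 0" if "a \<in> A" for a
    using x(3)[OF span_base[of "closest_point U a"]] that
    by (simp add: orthogonal_def P.sym[symmetric] closest_point_self[OF xU])
  then show ?thesis
    using that[of "x /\<^sub>R norm x"] x(1) xU by (simp add: subspace_scale[OF U])
qed

lemma admissible_pairs_cong:
  assumes "\<And>i. i < k \<Longrightarrow> u i = u' i" "\<And>i. i < k \<Longrightarrow> v i = v' i"
  shows "admissible_pairs U V u v k = admissible_pairs U V u' v' k"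
  using assms by (auto simp: admissible_pairs_def)

lemma compact_admissible_pairs:
  fixes U V :: "(real ^ 'n) set"
  assumes "subspace U" "subspace V"
  shows "compact (admissible_pairs U V u v k)"
proof -
  have eq: "admissible_pairs U V u v k = ((U \<inter> sphere 0 1) \<times> (V \<inter> sphere 0 1)) \<inter>
      (\<Inter>i\<in>{1..<k}. {z. fst z \<bullet> v i = 0} \<inter> {z. u i \<bullet> snd z = 0})"
    by (auto simp: admissible_pairs_def)
  show ?thesis
    unfolding eq
    by (intro compact_Int_closed compact_Times closed_INT closed_Int ballI closed_Collect_eq
        closed_Int_compact closed_subspace assms compact_sphere continuous_intros)
qed

lemma admissible_pairs_nonempty:
  fixes U V :: "(real ^ 'n) set"
  assumes "subspace U" "subspace V" and k: "k \<in> {1..min (dim U) (dim V)}"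
  shows "admissible_pairs U V u v k \<noteq> {}"
proof -
  have card: "card (f ` {1..<k}) < min (dim U) (dim V)" for f :: "nat \<Rightarrow> real ^ 'n"
    using card_image_le[of "{1..<k}" f] k by auto
  obtain x where "x \<in> U" "norm x = 1" "\<And>a. a \<in> v ` {1..<k} \<Longrightarrow> x \<bullet> a = 0"
    using unit_vector_in_subspace_orthogonal_to[OF assms(1), of "v ` {1..<k}"] card[of v] by auto
  moreover obtain y where "y \<in> V" "norm y = 1" "\<And>a. a \<in> u ` {1..<k} \<Longrightarrow> y \<bullet> a = 0"
    using unit_vector_in_subspace_orthogonal_to[OF assms(2), of "u ` {1..<k}"] card[of u] by auto
  ultimately have "(x, y) \<in> admissible_pairs U V u v k"
    by (simp add: admissible_pairs_def inner_commute[of _ y])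
  then show ?thesis by blast
qed

text \<open>Maximizers are added one index at a time, by compactness. Changing index
  \<open>Suc m\<close> leaves the earlier feasible sets alone, since these use only smaller
  indices.\<close>

lemma principal_vectors_exist:
  fixes U V :: "(real ^ 'n) set"
  assumes "subspace U" "subspace V"
  obtains u v where "principal_vectors U V u v"
proof -
  let ?max = "\<lambda>u v k. (u k, v k) \<in> admissible_pairs U V u v k \<and>
        (\<forall>(x, y)\<in>admissible_pairs U V u v k. x \<bullet> y \<le> u k \<bullet> v k)"
  have "\<exists>u v. \<forall>k\<in>{1..m}. ?max u v k" if "m \<le> min (dim U) (dim V)" for m
    using that
  proof (induction m)
    case 0
    show ?case by simp
  next
    case (Suc m)
    then obtain u v where uv: "\<forall>k\<in>{1..m}. ?max u v k" by auto
    let ?A = "admissible_pairs U V u v (Suc m)"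
    have "?A \<noteq> {}" using Suc.prems by (intro admissible_pairs_nonempty assms) auto
    moreover have "continuous_on ?A (\<lambda>z. fst z \<bullet> snd z)" by (intro continuous_intros)
    ultimately obtain z where z: "z \<in> ?A" "\<forall>z'\<in>?A. fst z' \<bullet> snd z' \<le> fst z \<bullet> snd z"
      using continuous_attains_sup[OF compact_admissible_pairs[OF assms]] by blast
    define x y where "x = fst z" and "y = snd z"
    have xy: "(x, y) \<in> ?A" "\<forall>z'\<in>?A. fst z' \<bullet> snd z' \<le> x \<bullet> y"
      using z by (simp_all add: x_def y_def)
    define u' v' where "u' = u(Suc m := x)" and "v' = v(Suc m := y)"
    have cong: "admissible_pairs U V u' v' k = admissible_pairs U V u v k" if "k \<le> Suc m" for k
      using that by (intro admissible_pairs_cong) (auto simp: u'_def v'_def)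
    have "?max u' v' k" if "k \<in> {1..Suc m}" for k
    proof (cases "k = Suc m")
      case True
      then show ?thesis using xy cong[of k] by (auto simp: u'_def v'_def)
    next
      case False
      then show ?thesis using uv that cong[of k] by (auto simp: u'_def v'_def)
    qed
    then show ?case by blast
  qed
  then show ?thesis using that unfolding principal_vectors_def by blast
qed

lemma unit_vectors_eqI:
  fixes x y :: "'a::real_inner"
  assumes "norm x = 1" "norm y = 1" "1 \<le> x \<bullet> y"
  shows "x = y"
proof -
  have "(x - y) \<bullet> (x - y) = x \<bullet> x + y \<bullet> y - 2 * (x \<bullet> y)"
    by (simp add: algebra_simps inner_commute)
  moreover have "x \<bullet> x = 1" "y \<bullet> y = 1" using assms by (simp_all add: dot_square_norm)
  ultimately have "(x - y) \<bullet> (x - y) \<le> 0" using assms(3) by linarith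
  then have "(x - y) \<bullet> (x - y) = 0" using inner_ge_zero[of "x - y"] by linarith
  then show ?thesis by (simp only: inner_eq_zero_iff right_minus_eq)
qed

text \<open>The first \<open>dim (U \<inter> V)\<close> principal vectors form an orthonormal basis of \<open>U \<inter> V\<close>,
  because as long as they do not span it, the maximum \<open>1\<close> is attained.\<close>

lemma principal_vectors_intersection:
  fixes U V :: "(real ^ 'n) set"
  assumes U: "subspace U" and V: "subspace V" and uv: "principal_vectors U V u v"
    and k: "k \<in> {1..dim (U \<inter> V)}"
  shows "u k = v k \<and> u k \<in> U \<inter> V"
  using k
proof (induction k rule: less_induct)
  case (less k)
  have W: "subspace (U \<inter> V)" using U V by (rule subspace_inter)
  have "dim (U \<inter> V) \<le> min (dim U) (dim V)" by (simp add: dim_subset)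
  then have k: "k \<in> {1..min (dim U) (dim V)}" using less.prems by auto
  have "card (u ` {1..<k}) < dim (U \<inter> V)"
    using card_image_le[of "{1..<k}" u] less.prems by auto
  then obtain x where x: "x \<in> U \<inter> V" "norm x = 1" "\<And>a. a \<in> u ` {1..<k} \<Longrightarrow> x \<bullet> a = 0"
    using unit_vector_in_subspace_orthogonal_to[OF W, of "u ` {1..<k}"] by auto
  have "u i = v i" if "i \<in> {1..<k}" for i using less that by auto
  then have "u i = v i" "x \<bullet> u i = 0" if "i \<in> {1..<k}" for i
    using that x(3) by simp_all
  then have "(x, x) \<in> admissible_pairs U V u v k"
    using x by (auto simp: admissible_pairs_def inner_commute[of _ x])
  then have "x \<bullet> x \<le> u k \<bullet> v k" and adm: "(u k, v k) \<in> admissible_pairs U V u v k"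
    using uv k by (auto simp: principal_vectors_def)
  then have "1 \<le> u k \<bullet> v k" using x(2) by (simp add: dot_square_norm)
  then show ?case
    using adm unit_vectors_eqI[of "u k" "v k"] by (auto simp: admissible_pairs_def)
qed

text \<open>The first \<open>dim (U \<inter> V)\<close> principal vectors span
  \<open>U \<inter> V\<close>, so the constraints at the next index no longer depend on the chosen
  maximizers.\<close>

lemma admissible_pairs_Friedrichs:
  fixes U V :: "(real ^ 'n) set"
  assumes U: "subspace U" and V: "subspace V" and uv: "principal_vectors U V u v"
  shows "admissible_pairs U V u v (dim (U \<inter> V) + 1) =
    {(x, y). x \<in> U \<and> y \<in> V \<and> norm x = 1 \<and> norm y = 1 \<and>
      (\<forall>w\<in>U \<inter> V. x \<bullet> w = 0 \<and> y \<bullet> w = 0)}"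
proof -
  define s where "s = dim (U \<inter> V)"
  have le: "s \<le> min (dim U) (dim V)" by (simp add: dim_subset s_def)
  note uvW = principal_vectors_intersection[OF U V uv, folded s_def]
  have adm: "(u k, v k) \<in> admissible_pairs U V u v k" if "k \<in> {1..s}" for k
    using uv that le by (auto simp: principal_vectors_def)
  have n1: "norm (u k) = 1" if "k \<in> {1..s}" for k
    using adm[OF that] by (auto simp: admissible_pairs_def)
  have less: "u j \<bullet> u i = 0" if "i \<in> {1..s}" "j \<in> {1..s}" "i < j" for i j
    using adm[OF that(2)] uvW[OF that(1)] that by (auto simp: admissible_pairs_def)
  then have orth: "u i \<bullet> u j = 0" if "i \<in> {1..s}" "j \<in> {1..s}" "i \<noteq> j" for i j
    using that less[of j i] less[of i j] by (cases "i < j") (auto simp: inner_commute)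
  have "inj_on u {1..s}"
    using orth n1 by (metis inj_onI inner_eq_zero_iff norm_zero zero_neq_one)
  then have card: "card (u ` {1..s}) = s" by (simp add: card_image)
  have ind: "independent (u ` {1..s})"
  proof (rule pairwise_orthogonal_independent)
    show "pairwise orthogonal (u ` {1..s})"
      using orth unfolding pairwise_def orthogonal_def by blast
    show "0 \<notin> u ` {1..s}" using n1 by (metis imageE norm_zero zero_neq_one)
  qed
  have W: "U \<inter> V \<subseteq> span (u ` {1..s})"
  proof (rule card_ge_dim_independent[OF _ ind])
    show "u ` {1..s} \<subseteq> U \<inter> V" using uvW by blast
    show "dim (U \<inter> V) \<le> card (u ` {1..s})" unfolding card by (simp add: s_def)
  qed
  have "(\<forall>i\<in>{1..<s + 1}. x \<bullet> v i = 0 \<and> u i \<bullet> y = 0) \<longleftrightarrow> (\<forall>w\<in>U \<inter> V. x \<bullet> w = 0 \<and> y \<bullet> w = 0)" for x y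
  proof
    assume *: "\<forall>i\<in>{1..<s + 1}. x \<bullet> v i = 0 \<and> u i \<bullet> y = 0"
    have "orthogonal x (u i) \<and> orthogonal y (u i)" if "i \<in> {1..s}" for i
    proof -
      have "u i = v i" by (rule uvW[OF that, THEN conjunct1])
      moreover have "i \<in> {1..<s + 1}" using that by simp
      ultimately have "x \<bullet> u i = 0" "u i \<bullet> y = 0" using * by metis+
      then show ?thesis unfolding orthogonal_def by (metis inner_commute)
    qed
    then have u: "orthogonal x a \<and> orthogonal y a" if "a \<in> u ` {1..s}" for a
      using that by blast
    have "orthogonal x w \<and> orthogonal y w" if "w \<in> U \<inter> V" for w
      using W that u orthogonal_to_span[of w "u ` {1..s}"] by blast
    then show "\<forall>w\<in>U \<inter> V. x \<bullet> w = 0 \<and> y \<bullet> w = 0" by (simp add: orthogonal_def)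
  next
    assume *: "\<forall>w\<in>U \<inter> V. x \<bullet> w = 0 \<and> y \<bullet> w = 0"
    show "\<forall>i\<in>{1..<s + 1}. x \<bullet> v i = 0 \<and> u i \<bullet> y = 0"
    proof
      fix i assume "i \<in> {1..<s + 1}"
      then have "u i \<in> U \<inter> V" "v i \<in> U \<inter> V" using uvW[of i] by auto
      then show "x \<bullet> v i = 0 \<and> u i \<bullet> y = 0" using * by (auto simp: inner_commute)
    qed
  qed
  then show ?thesis by (auto simp: admissible_pairs_def s_def)
qed

text \<open>\<open>F\<close> is independent of the principal vectors, so every choice attains the
  same maximum and the \<open>THE\<close> in \<open>principal_angle\<close> denotes its
  \<open>arccos\<close>.\<close>

lemma friedrichs_angle:
  fixes U V :: "(real ^ 'n) set"
  assumes U: "subspace U" and V: "subspace V" and dim: "dim (U \<inter> V) < min (dim U) (dim V)"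
  defines "F \<equiv> {(x, y). x \<in> U \<and> y \<in> V \<and> norm x = 1 \<and> norm y = 1 \<and>
      (\<forall>w\<in>U \<inter> V. x \<bullet> w = 0 \<and> y \<bullet> w = 0)}"
  obtains x y where "(x, y) \<in> F" "x \<bullet> y = cos (friedrichs_angle U V)"
    "\<And>x' y'. (x', y') \<in> F \<Longrightarrow> x' \<bullet> y' \<le> cos (friedrichs_angle U V)"
    "friedrichs_angle U V \<in> {0..pi / 2}" "cos (friedrichs_angle U V) < 1"
proof -
  let ?k = "dim (U \<inter> V) + 1"
  have kin: "?k \<in> {1..min (dim U) (dim V)}" using dim by auto
  have max: "(u ?k, v ?k) \<in> F" "(x, y) \<in> F \<Longrightarrow> x \<bullet> y \<le> u ?k \<bullet> v ?k"
    if "principal_vectors U V u v" for u v x y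
    using that kin admissible_pairs_Friedrichs[OF U V that] unfolding principal_vectors_def F_def by blast+
  obtain u v where uv: "principal_vectors U V u v" using principal_vectors_exist[OF U V] by blast
  define x y where "x = u ?k" and "y = v ?k"
  have xy: "(x, y) \<in> F" "\<And>x' y'. (x', y') \<in> F \<Longrightarrow> x' \<bullet> y' \<le> x \<bullet> y"
    using max[OF uv] by (simp_all add: x_def y_def)
  \<comment> \<open>\<open>F\<close> is stable under a sign change, so its maximum is nonnegative
    and the angle is at most \<open>pi / 2\<close>.\<close>
  have "(- x, y) \<in> F" using xy(1) U by (auto simp: F_def subspace_neg)
  then have ge0: "0 \<le> x \<bullet> y" using xy(2)[of "- x" y] by simp
  \<comment> \<open>The value 1 would put \<open>x = y\<close> into \<open>U \<inter> V\<close>, to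
    which \<open>x\<close> is orthogonal.\<close>
  have lt1: "x \<bullet> y < 1"
  proof (rule ccontr)
    assume "\<not> x \<bullet> y < 1"
    then have "x = y" using xy(1) unit_vectors_eqI[of x y] by (simp add: F_def)
    then have "x \<bullet> x = 0" "norm x = 1" using xy(1) by (simp_all add: F_def)
    then show False by simp
  qed
  have "friedrichs_angle U V = arccos (x \<bullet> y)"
    unfolding friedrichs_angle_def principal_angle_def
  proof (rule the_equality)
    have "cos (arccos (x \<bullet> y)) = u ?k \<bullet> v ?k" "arccos (x \<bullet> y) \<in> {0..pi / 2}"
      using ge0 lt1 arccos_le_pi2[OF ge0] arccos_lbound[of "x \<bullet> y"] by (simp_all add: x_def y_def)
    then show "arccos (x \<bullet> y) \<in> {0..pi / 2} \<and>
      (\<exists>u v. principal_vectors U V u v \<and> cos (arccos (x \<bullet> y)) = u ?k \<bullet> v ?k)"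
      using uv by blast
  next
    fix \<theta> assume \<theta>: "\<theta> \<in> {0..pi / 2} \<and> (\<exists>u v. principal_vectors U V u v \<and> cos \<theta> = u ?k \<bullet> v ?k)"
    then obtain u' v' where uv': "principal_vectors U V u' v'" "cos \<theta> = u' ?k \<bullet> v' ?k" by blast
    have "u' ?k \<bullet> v' ?k = x \<bullet> y"
      using max(2)[OF uv'(1) xy(1)] xy(2)[OF max(1)[OF uv'(1)]] by simp
    then show "\<theta> = arccos (x \<bullet> y)" using \<theta> uv'(2) arccos_cos[of \<theta>] by simp
  qed
  then have "cos (friedrichs_angle U V) = x \<bullet> y" "friedrichs_angle U V \<in> {0..pi / 2}"
    using ge0 lt1 arccos_le_pi2[OF ge0] arccos_lbound[of "x \<bullet> y"] by simp_all
  then show ?thesis using that[of x y] xy lt1 by simp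
qed

subsection \<open>The generalized alternating projections matrix\<close>

lemma matrix_power_mult_vec: "matrix_power A k *v x = (((*v) A) ^^ k) x"
  by (induction k) (simp_all flip: matrix_vector_mul_assoc)

lemma map_matrix_of_real_mult_vec:
  "Re ((map_matrix complex_of_real A *v z) $ i) = (A *v (\<chi> j. Re (z $ j))) $ i"
  "Im ((map_matrix complex_of_real A *v z) $ i) = (A *v (\<chi> j. Im (z $ j))) $ i"
  by (simp_all add: matrix_vector_mult_def)

text \<open>Real and imaginary parts of a complex eigenvector bring the spectrum into the real form
  used in \<open>eigenvalue_modulus\<close>.\<close>

lemma mem_spectrum_iff:
  "l \<in> spectrum A \<longleftrightarrow> (\<exists>x y. (x \<noteq> 0 \<or> y \<noteq> 0) \<and>
     A *v x = Re l *\<^sub>R x - Im l *\<^sub>R y \<and> A *v y = Im l *\<^sub>R x + Re l *\<^sub>R y)"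
  (is "?L \<longleftrightarrow> ?R")
proof
  assume ?L
  then obtain z where z: "z \<noteq> 0" "map_matrix complex_of_real A *v z = l *s z"
    by (auto simp: spectrum_def)
  define x y where "x = (\<chi> j. Re (z $ j))" and "y = (\<chi> j. Im (z $ j))"
  have "x \<noteq> 0 \<or> y \<noteq> 0"
    using z(1) by (auto simp: x_def y_def vec_eq_iff complex_eq_iff)
  moreover have "A *v x = Re l *\<^sub>R x - Im l *\<^sub>R y" "A *v y = Im l *\<^sub>R x + Re l *\<^sub>R y"
    using map_matrix_of_real_mult_vec[of A z] z(2)
    by (simp_all add: vec_eq_iff x_def y_def algebra_simps)
  ultimately show ?R by blast
next
  assume ?R
  then obtain x y where xy: "x \<noteq> 0 \<or> y \<noteq> 0"
    "A *v x = Re l *\<^sub>R x - Im l *\<^sub>R y" "A *v y = Im l *\<^sub>R x + Re l *\<^sub>R y" by blast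
  define z where "z = (\<chi> j. Complex (x $ j) (y $ j))"
  have "z \<noteq> 0" using xy(1) by (auto simp: z_def vec_eq_iff complex_eq_iff)
  moreover have "map_matrix complex_of_real A *v z = l *s z"
    using map_matrix_of_real_mult_vec[of A z] xy(2,3)
    by (simp add: vec_eq_iff complex_eq_iff z_def algebra_simps)
  ultimately show ?L by (auto simp: spectrum_def)
qed

theorem theorem1:
  fixes U V :: "(real ^ 'n) set"
    and \<alpha> \<alpha>\<^sub>1 \<alpha>\<^sub>2 \<alpha>_opt \<gamma>_opt :: real
    and S :: "real ^ 'n ^ 'n"
  assumes "subspace U" and "subspace V"
    and "dim (U \<inter> V) < min (dim U) (dim V)"
    and "\<alpha>_opt = 2 / (1 + sin (friedrichs_angle U V))"
    and "\<gamma>_opt = (1 - sin (friedrichs_angle U V)) / (1 + sin (friedrichs_angle U V))"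
    and "\<alpha> = 1" and "\<alpha>\<^sub>1 = \<alpha>_opt" and "\<alpha>\<^sub>2 = \<alpha>_opt"
    and "S = matrix (gap_operator U V \<alpha> \<alpha>\<^sub>1 \<alpha>\<^sub>2)"
  shows "subdominant_modulus S = \<gamma>_opt \<and>
         (\<forall>\<mu>\<in>{\<gamma>_opt<..<1}. linearly_convergent S \<mu>)"
proof -
  note U = assms(1) and V = assms(2)
  have W: "subspace (U \<inter> V)" by (rule subspace_inter[OF U V])
  define \<theta> where "\<theta> = friedrichs_angle U V"
  define p q e where "p = closest_point U" and "q = closest_point V" and "e = closest_point (U \<inter> V)"
  obtain x y where xy: "x \<in> U" "y \<in> V" "norm x = 1" "norm y = 1"
      "\<forall>w\<in>U \<inter> V. x \<bullet> w = 0" "\<forall>w\<in>U \<inter> V. y \<bullet> w = 0" "x \<bullet> y = cos \<theta>"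
    and max: "\<And>x y. \<lbrakk>x \<in> U; y \<in> V; norm x = 1; norm y = 1;
      \<forall>w\<in>U \<inter> V. x \<bullet> w = 0; \<forall>w\<in>U \<inter> V. y \<bullet> w = 0\<rbrakk> \<Longrightarrow> x \<bullet> y \<le> cos \<theta>"
    and \<theta>: "\<theta> \<in> {0..pi / 2}" "cos \<theta> < 1"
    by (rule friedrichs_angle[OF U V assms(3), folded \<theta>_def]) auto
  have proj: "orth_projection p" "orth_projection q" "orth_projection e"
    by (simp_all add: p_def q_def e_def orth_projection_closest_point U V W)
  have fix_iff: "p z = z \<longleftrightarrow> z \<in> U" "q z = z \<longleftrightarrow> z \<in> V" "e z = 0 \<longleftrightarrow> (\<forall>w\<in>U \<inter> V. z \<bullet> w = 0)" for z
    by (simp_all add: p_def q_def e_def closest_point_subspace_eq_iff closest_point_subspace_eq_0_iff U V W)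
  interpret projection_pair p q e "cos \<theta>" "sin \<theta>" \<gamma>_opt
  proof (intro projection_pair.intro projection_pair_axioms.intro proj)
    show "e (p z) = e z" "e (q z) = e z" "p (e z) = e z" "q (e z) = e z" for z
      unfolding p_def q_def e_def by (intro closest_point_smaller_subspace U V W; simp)+
    show "0 \<le> cos \<theta>" "cos \<theta> < 1" "0 \<le> sin \<theta>"
      using \<theta> by (auto intro!: cos_ge_zero sin_ge_zero)
    show "(sin \<theta>)\<^sup>2 = 1 - (cos \<theta>)\<^sup>2" by (rule sin_squared_eq)
    show "\<gamma>_opt = (1 - sin \<theta>) / (1 + sin \<theta>)" using assms(5) by (simp add: \<theta>_def)
  next
    fix u v assume uv: "p u = u" "e u = 0" "q v = v" "e v = 0"
    show "u \<bullet> v \<le> cos \<theta> * norm u * norm v"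
    proof (cases "u = 0 \<or> v = 0")
      case False
      then have "(u /\<^sub>R norm u) \<bullet> (v /\<^sub>R norm v) \<le> cos \<theta>"
        using uv U V unfolding fix_iff by (intro max) (auto simp: subspace_scale)
      then show ?thesis using False by (simp add: field_simps)
    qed auto
  qed
  have "1 + sin \<theta> \<noteq> 0" using s_pos by simp
  then have \<alpha>_opt: "\<alpha>_opt = 1 + \<gamma>_opt"
    unfolding assms(4,5) \<theta>_def by (simp add: add_divide_distrib[symmetric] add_divide_eq_if_simps)
  have gap: "gap_operator U V \<alpha> \<alpha>\<^sub>1 \<alpha>\<^sub>2 z = T z" for z
    unfolding T_def A_def B_def gap_operator_def relaxed_proj_def assms(6,7,8) \<alpha>_opt
      p_def[symmetric] q_def[symmetric]
    by (simp add: algebra_simps)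
  have S: "S *v z = T z" for z
    using linear_gap_operator[OF U V] by (simp add: assms(9) matrix_works gap)
  have Sk: "matrix_power S k *v z = (T ^^ k) z" for k z
  proof -
    have "(*v) S = T" using S by blast
    then show ?thesis by (simp add: matrix_power_mult_vec)
  qed
  have b2: "\<gamma>_opt\<^sup>2 \<le> \<gamma>_opt"
    using b_range by (simp add: power2_eq_square mult_left_le)
  have spec: "cmod l \<in> {0, \<gamma>_opt, \<gamma>_opt\<^sup>2}" if l: "l \<in> spectrum S" "l \<noteq> 1" for l
  proof -
    obtain x y where "x \<noteq> 0 \<or> y \<noteq> 0" "T x = Re l *\<^sub>R x - Im l *\<^sub>R y" "T y = Im l *\<^sub>R x + Re l *\<^sub>R y"
      using l(1) unfolding mem_spectrum_iff S by metis
    then have "(Re l)\<^sup>2 + (Im l)\<^sup>2 \<in> {0, \<gamma>_opt\<^sup>2, (\<gamma>_opt\<^sup>2)\<^sup>2}"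
      using eigenvalue_modulus[of x "Re l" "Im l" y] l(2) by (auto simp: complex_eq_iff)
    then have "(cmod l)\<^sup>2 \<in> {0\<^sup>2, \<gamma>_opt\<^sup>2, (\<gamma>_opt\<^sup>2)\<^sup>2}" by (simp add: cmod_power2)
    moreover have "cmod l = t" if "(cmod l)\<^sup>2 = t\<^sup>2" "0 \<le> t" for t
      by (rule power2_eq_imp_eq[OF that(1) norm_ge_zero that(2)])
    ultimately show ?thesis
      using b_range(1) order_refl[of "0::real"] zero_le_power2[of \<gamma>_opt] by blast
  qed
  have "\<gamma>_opt \<in> cmod ` ({0} \<union> (spectrum S - {1}))"
  \<comment> \<open>A zero rate is attained by the 0 adjoined to the spectrum; otherwise the optimal
    pair supplies an eigenvector.\<close>
  proof (cases "\<gamma>_opt = 0")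
    case False
    obtain z where "z \<noteq> 0" "T z = \<gamma>_opt *\<^sub>R z"
      by (rule eigenvector_b[of x y]) (use xy False in \<open>simp_all add: fix_iff\<close>)
    then have "complex_of_real \<gamma>_opt \<in> spectrum S"
      unfolding mem_spectrum_iff S by (intro exI[of _ z] exI[of _ 0]) (simp add: linear_0[OF linear_T])
    then show ?thesis
      using b_range by (intro image_eqI[of _ _ "complex_of_real \<gamma>_opt"]) auto
  qed auto
  moreover have sub: "cmod ` ({0} \<union> (spectrum S - {1})) \<subseteq> {0, \<gamma>_opt, \<gamma>_opt\<^sup>2}"
  proof (intro image_subsetI)
    fix l assume "l \<in> {0} \<union> (spectrum S - {1})"
    then show "cmod l \<in> {0, \<gamma>_opt, \<gamma>_opt\<^sup>2}"
      using spec[of l] by (cases "l = 0") simp_all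
  qed
  ultimately have "subdominant_modulus S = \<gamma>_opt"
    unfolding subdominant_modulus_def
  proof (intro Max_eqI)
    show "finite (cmod ` ({0} \<union> (spectrum S - {1})))"
      by (rule finite_subset[OF sub]) simp
    show "r \<le> \<gamma>_opt" if "r \<in> cmod ` ({0} \<union> (spectrum S - {1}))" for r
      using subsetD[OF sub that] b2 b_range by auto
  qed
  moreover have "linearly_convergent S \<mu>" if "\<mu> \<in> {\<gamma>_opt<..<1}" for \<mu>
  proof -
    have \<mu>: "\<gamma>_opt < \<mu>" "\<mu> < 1" using that by auto
    \<comment> \<open>The limit is the projection onto \<open>U \<inter> V\<close>. The estimate
      holds for every \<open>k\<close>, so the threshold 1 chosen below is arbitrary.\<close>
    have E: "matrix e *v z = e z" for z using E.lin by (simp add: matrix_works)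
    have "onorm ((*v) (matrix_power S k - matrix e)) \<le> (1 + 2 / (\<mu> - \<gamma>_opt)) * \<mu> ^ k" for k
      using convergence[OF \<mu>, of k] \<mu> b_range
      by (intro onorm_bound) (auto simp: matrix_vector_mult_diff_rdistrib Sk E intro!: mult_nonneg_nonneg add_nonneg_nonneg)
    moreover have "0 < 1 + 2 / (\<mu> - \<gamma>_opt)" using \<mu> by (simp add: add_pos_pos)
    ultimately show ?thesis
      unfolding linearly_convergent_def using \<mu> b_range
      by (intro conjI exI[of _ "matrix e"] exI[of _ "1 + 2 / (\<mu> - \<gamma>_opt)"] exI[of _ 1]) auto
  qed
  ultimately show ?thesis by blast
qed

end
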